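(* The censorship of coherence $(\mathcal{F},\mathcal{CO}_{\mathrm{SIO}})$ is secure against account sharing. That is: let $N\ge1$, $\epsilon\in[0,1)$, and $\Omega(\rho)=\epsilon\rho+(1-\epsilon)\Delta(\rho)$ on $\mathbb{C}^d$ with $\Delta(\rho)=\sum_a|a\rangle\langle a|\rho|a\rangle\langle a|$. For every state $\rho\notin\mathcal{F}(A_1\dots A_N)$, all independent parties $C_1,\dots,C_M$, every state $\omega_C$ of $C_1\dots C_M$, and every incoherent separable operation $\Lambda\in\mathcal{O}_{\mathrm{SIO}}(B_1\dots B_NC_1\dots C_M)$, $$\mathrm{Tr}_{C_1\dots C_M}\{\Lambda(\Omega^{\otimes N}(\rho)\otimes\omega_C)\}\neq\rho.$$
   Context: Resource theory of coherence: each sender system $A_i$ and receiver system $B_i$ has Hilbert space $\mathbb{C}^d$ with fixed incoherent orthonormal basis $\{|a\rangle\}_{a=0}^{d-1}$ ($A_i$ and $B_i$ are identified), and every independent party $C_j$ has a finite-dimensional Hilbert space with its own fixed incoherent orthonormal basis. $\mathcal{F}(A_1\dots A_N)$ is the set of density operators diagonal in the product basis $|a_1\dots a_N\rangle$. $\mathcal{O}_{\mathrm{SIO}}(B_1\dots B_NC_1\dots C_M)$ is the set of channels (trace-preserving maps) of the form $$\Lambda=\sum_b\Lambda^b_{B_1}\otimes\dots\otimes\Lambda^b_{B_N}\otimes\Lambda^b_{C_1}\otimes\dots\otimes\Lambda^b_{C_M},$$ where each local map $\Lambda^b_X$ is a (possibly probabilistic, i.e. trace-non-increasing) incoherent operation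 on $X$: $\Lambda^b_X(\rho)=\sum_aM_a\rho M_a^\dagger$ with $\sum_aM_a^\dagger M_a\le\mathbb{1}$ and $M_a=\sum_kc_{ak}|f_a(k)\rangle\langle k|$, where $k$ runs over the labels of the incoherent basis of $X$, $c_{ak}\in\mathbb{C}$, and $f_a$ maps labels to labels. $\mathcal{CO}_{\mathrm{SIO}}$ denotes the catalytic transformations $\gamma\mapsto\mathrm{Tr}_{C_1\dots C_M}\{\Lambda(\gamma\otimes\omega_C)\}$ with $\Lambda\in\mathcal{O}_{\mathrm{SIO}}(B_1\dots B_NC_1\dots C_M)$ and $\omega_C$ an arbitrary state of the uncensored independent parties. Censorship is secure against account sharing if no $\rho\notin\mathcal{F}(A_1\dots A_N)$ can be recovered from $\Omega^{\otimes N}(\rho)$ by such a catalytic transformation. *)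

theory Defs
  imports "Jordan_Normal_Form.Schur_Decomposition"
begin

type_synonym cmat = "complex mat"

definition mat_sum :: "nat \<Rightarrow> 'a set \<Rightarrow> ('a \<Rightarrow> cmat) \<Rightarrow> cmat" where
  "mat_sum n I A = mat n n (\<lambda>(i, j). \<Sum>a\<in>I. A a $$ (i, j))"

definition mat_trace :: "cmat \<Rightarrow> complex" where
  "mat_trace A = (\<Sum>i<dim_row A. A $$ (i, i))"

definition mat_unit :: "nat \<Rightarrow> nat \<Rightarrow> nat \<Rightarrow> cmat" where
  "mat_unit n i j = mat n n (\<lambda>(r, s). if r = i \<and> s = j then 1 else 0)"

text \<open>The order on \<^typ>\<open>complex\<close> makes \<open>0 \<le> z\<close> say that \<open>z\<close> is real and
  nonnegative, so this notion includes self-adjointness.\<close>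

definition psd :: "nat \<Rightarrow> cmat \<Rightarrow> bool" where
  "psd n A \<longleftrightarrow> A \<in> carrier_mat n n \<and> (\<forall>v\<in>carrier_vec n. 0 \<le> (A *\<^sub>v v) \<bullet>c v)"

definition density :: "nat \<Rightarrow> cmat \<Rightarrow> bool" where
  "density n \<rho> \<longleftrightarrow> psd n \<rho> \<and> mat_trace \<rho> = 1"


text \<open>Composite systems. The incoherent basis of a system of dimension \<open>n\<close> is its standard
  basis, labelled \<open>0, \<dots>, n - 1\<close>. In the composite of systems of dimensions \<open>n\<close> and \<open>m\<close>
  the product basis vector with labels \<open>(i, k)\<close> is the standard basis vector with number
  \<open>i * m + k\<close>; iterating this, a list of systems with dimensions \<open>ds\<close> has dimension
  \<open>prod_list ds\<close>, and its product basis is again the standard basis.\<close>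

definition kron :: "cmat \<Rightarrow> cmat \<Rightarrow> cmat" where
  "kron A B = mat (dim_row A * dim_row B) (dim_col A * dim_col B)
     (\<lambda>(r, s). A $$ (r div dim_row B, s div dim_col B) * B $$ (r mod dim_row B, s mod dim_col B))"

text \<open>Trace over the second factor of a composite of dimension \<open>n * m\<close>.\<close>

definition partial_trace :: "nat \<Rightarrow> nat \<Rightarrow> cmat \<Rightarrow> cmat" where
  "partial_trace n m X = mat n n (\<lambda>(i, j). \<Sum>k<m. X $$ (i * m + k, j * m + k))"

text \<open>The linear map that sends \<open>A \<otimes> B\<close> to \<open>E A \<otimes> F B\<close>, for linear maps \<open>E\<close>, \<open>F\<close> on
  the matrices of dimension \<open>n\<close>, \<open>m\<close>: expand the argument into products of matrix units.\<close>

definition map_tensor ::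
  "nat \<Rightarrow> nat \<Rightarrow> (cmat \<Rightarrow> cmat) \<Rightarrow> (cmat \<Rightarrow> cmat) \<Rightarrow> cmat \<Rightarrow> cmat" where
  "map_tensor n m E F X =
     mat_sum (n * m) (({..<n} \<times> {..<n}) \<times> ({..<m} \<times> {..<m}))
       (\<lambda>((i, j), (k, l)). X $$ (i * m + k, j * m + l) \<cdot>\<^sub>m kron (E (mat_unit n i j)) (F (mat_unit m k l)))"

text \<open>Each party is given by its dimension and a linear map on its matrices. The empty
  composite is one-dimensional.\<close>

fun maps_tensor :: "(nat \<times> (cmat \<Rightarrow> cmat)) list \<Rightarrow> cmat \<Rightarrow> cmat" where
  "maps_tensor [] = (\<lambda>X. X)"
| "maps_tensor ((n, E) # Es) = map_tensor n (prod_list (map fst Es)) E (maps_tensor Es)"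


definition dephasing :: "nat \<Rightarrow> cmat \<Rightarrow> cmat" where
  "dephasing d \<rho> = mat_sum d {..<d} (\<lambda>a. mat_unit d a a * \<rho> * mat_unit d a a)"

definition censor :: "nat \<Rightarrow> real \<Rightarrow> cmat \<Rightarrow> cmat" where
  "censor d \<epsilon> \<rho> = of_real \<epsilon> \<cdot>\<^sub>m \<rho> + of_real (1 - \<epsilon>) \<cdot>\<^sub>m dephasing d \<rho>"

definition censor_power :: "nat \<Rightarrow> nat \<Rightarrow> real \<Rightarrow> cmat \<Rightarrow> cmat" where
  "censor_power N d \<epsilon> = maps_tensor (replicate N (d, censor d \<epsilon>))"

definition free_states :: "nat list \<Rightarrow> cmat set" where
  "free_states ds = {\<rho>. density (prod_list ds) \<rho> \<and> diagonal_mat \<rho>}"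


definition incoherent_kraus :: "nat \<Rightarrow> cmat \<Rightarrow> bool" where
  "incoherent_kraus d M \<longleftrightarrow>
     (\<exists>f c. (\<forall>k<d. f k < d) \<and> M = mat_sum d {..<d} (\<lambda>k. c k \<cdot>\<^sub>m mat_unit d (f k) k))"

definition incoherent_op :: "nat \<Rightarrow> (cmat \<Rightarrow> cmat) \<Rightarrow> bool" where
  "incoherent_op d \<Lambda> \<longleftrightarrow>
     (\<exists>(K :: nat) M. (\<forall>a<K. incoherent_kraus d (M a)) \<and>
        psd d (1\<^sub>m d - mat_sum d {..<K} (\<lambda>a. mat_adjoint (M a) * M a)) \<and>
        (\<forall>\<rho>\<in>carrier_mat d d. \<Lambda> \<rho> = mat_sum d {..<K} (\<lambda>a. M a * \<rho> * mat_adjoint (M a))))"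

text \<open>Complete positivity need not be required separately: it follows from the product form.\<close>

definition SIO :: "nat list \<Rightarrow> (cmat \<Rightarrow> cmat) set" where
  "SIO ds = {\<Lambda>.
     (\<forall>X\<in>carrier_mat (prod_list ds) (prod_list ds). mat_trace (\<Lambda> X) = mat_trace X) \<and>
     (\<exists>(K :: nat) L. (\<forall>b<K. list_all2 incoherent_op ds (L b)) \<and>
        (\<forall>X\<in>carrier_mat (prod_list ds) (prod_list ds).
           \<Lambda> X = mat_sum (prod_list ds) {..<K} (\<lambda>b. maps_tensor (zip ds (L b)) X)))}"

text \<open>Receivers have dimensions \<open>ds\<close>; the list \<open>es\<close> of the dimensions of the independent
  parties, and with it their number, is arbitrary, as is their joint state \<open>\<omega>\<close>.\<close>

definition CO_SIO :: "nat list \<Rightarrow> (cmat \<Rightarrow> cmat) set" where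
  "CO_SIO ds = {\<Phi>. \<exists>es \<omega> \<Lambda>. density (prod_list es) \<omega> \<and> \<Lambda> \<in> SIO (ds @ es) \<and>
     \<Phi> = (\<lambda>\<gamma>. partial_trace (prod_list ds) (prod_list es) (\<Lambda> (kron \<gamma> \<omega>)))}"

text \<open>\<open>F\<close>: free states; \<open>T\<close>: available transformations; \<open>C\<close>: joint action of the censors;
  \<open>n\<close>: total dimension of the senders.\<close>

definition secure_against_account_sharing ::
  "nat \<Rightarrow> cmat set \<Rightarrow> (cmat \<Rightarrow> cmat) set \<Rightarrow> (cmat \<Rightarrow> cmat) \<Rightarrow> bool" where
  "secure_against_account_sharing n F T C \<longleftrightarrow>
     (\<forall>\<rho>. density n \<rho> \<and> \<rho> \<notin> F \<longrightarrow> (\<forall>\<Phi>\<in>T. \<Phi> (C \<rho>) \<noteq> \<rho>))"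

end

theory Submission
  imports Defs
begin

text \<open>The \<open>l\<^sub>1\<close>-norm of coherence, the sum of the moduli of the off-diagonal entries, separates
  \<open>\<rho>\<close> from what the receivers can produce. The censors multiply each off-diagonal entry by a
  positive power of \<open>\<epsilon>\<close>, so they shrink this norm by a factor at most \<open>\<epsilon> < 1\<close>. A catalytic
  transformation cannot increase it: its Kraus operators are products \<open>P\<^sub>i \<otimes> Q\<^sub>i\<close> with \<open>P\<^sub>i\<close>
  incoherent, so tracing out the independent parties leaves
  \<open>\<gamma> \<mapsto> \<Sum>i. w\<^sub>i P\<^sub>i \<gamma> P\<^sub>i\<^sup>*\<close> with weights \<open>w\<^sub>i = Tr (Q\<^sub>i \<omega> Q\<^sub>i\<^sup>*) \<ge> 0\<close>; the shared state
  enters only through these weights. If \<open>p\<^sub>i(x)\<close> is the squared modulus of the nonzero entry in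
  column \<open>x\<close> of \<open>P\<^sub>i\<close>, then trace preservation gives \<open>\<Sum>i. w\<^sub>i p\<^sub>i(x) = 1\<close>, and AM-GM shows that
  the entry \<open>\<gamma>\<^sub>x\<^sub>y\<close> contributes at most \<open>\<bar>\<gamma>\<^sub>x\<^sub>y\<bar> \<Sum>i. w\<^sub>i (p\<^sub>i(x) + p\<^sub>i(y)) / 2 = \<bar>\<gamma>\<^sub>x\<^sub>y\<bar>\<close>.\<close>

section \<open>Arithmetic of the encoding \<open>i * m + k\<close> of product basis labels\<close>

lemma sum_lessThan_mult:
  fixes f :: "nat \<Rightarrow> 'a :: comm_monoid_add"
  shows "(\<Sum>r<n * m. f r) = (\<Sum>i<n. \<Sum>k<m. f (i * m + k))"
proof -
  have "sum f {i * m..<i * m + m} = (\<Sum>k<m. f (i * m + k))" for i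
    by (rule sum.reindex_bij_witness[of _ "\<lambda>k. i * m + k" "\<lambda>r. r - i * m"]) auto
  then show ?thesis
    unfolding sum.nat_group[of f m n, symmetric] by simp
qed

lemma mult_add_less:
  fixes i k n m :: nat
  assumes "i < n" "k < m"
  shows "i * m + k < n * m"
proof -
  have "i * m + k < Suc i * m" using assms by simp
  also have "\<dots> \<le> n * m" using assms by (intro mult_le_mono1) simp
  finally show ?thesis .
qed

lemma div_mod_less:
  fixes r n m :: nat
  assumes "r < n * m"
  shows "r div m < n" "r mod m < m"
proof -
  have "m > 0" using assms by (cases m) auto
  then show "r div m < n" "r mod m < m"
    using assms by (auto simp: less_mult_imp_div_less)
qed


subsection \<open>Matrix entries\<close>

lemma mat_sum_carrier [simp]: "mat_sum n I A \<in> carrier_mat n n"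
  by (simp add: mat_sum_def)

lemma mat_sum_dim [simp]: "dim_row (mat_sum n I A) = n" "dim_col (mat_sum n I A) = n"
  by (simp_all add: mat_sum_def)

lemma mat_sum_index [simp]:
  "i < n \<Longrightarrow> j < n \<Longrightarrow> mat_sum n I A $$ (i, j) = (\<Sum>a\<in>I. A a $$ (i, j))"
  by (simp add: mat_sum_def)

lemma mat_unit_carrier [simp]: "mat_unit n i j \<in> carrier_mat n n"
  by (simp add: mat_unit_def)

lemma mat_unit_dim [simp]: "dim_row (mat_unit n i j) = n" "dim_col (mat_unit n i j) = n"
  by (simp_all add: mat_unit_def)

lemma mat_unit_index [simp]:
  "r < n \<Longrightarrow> s < n \<Longrightarrow> mat_unit n i j $$ (r, s) = (if r = i \<and> s = j then 1 else 0)"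
  by (simp add: mat_unit_def)

lemma mat_adjoint_dim [simp]:
  "dim_row (mat_adjoint A) = dim_col A" "dim_col (mat_adjoint A) = dim_row A"
  by (simp_all add: mat_adjoint_def)

lemma mat_adjoint_carrier [simp]:
  "A \<in> carrier_mat n m \<Longrightarrow> mat_adjoint A \<in> carrier_mat m n"
  by (intro carrier_matI) (simp_all add: carrier_matD)

lemma mat_adjoint_index [simp]:
  fixes A :: cmat
  shows "i < dim_col A \<Longrightarrow> j < dim_row A \<Longrightarrow> mat_adjoint A $$ (i, j) = cnj (A $$ (j, i))"
  by (simp add: mat_adjoint_def mat_of_rows_index)

lemma mult_mat_index:
  fixes A B :: cmat
  assumes "A \<in> carrier_mat n m" "B \<in> carrier_mat m l" "i < n" "j < l"
  shows "(A * B) $$ (i, j) = (\<Sum>k<m. A $$ (i, k) * B $$ (k, j))"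
  using assms by (simp add: scalar_prod_def atLeast0LessThan)

lemma sandwich_index:
  fixes M X :: cmat
  assumes M: "M \<in> carrier_mat n n" and X: "X \<in> carrier_mat n n" and "r < n" "s < n"
  shows "(M * X * mat_adjoint M) $$ (r, s) =
    (\<Sum>x<n. \<Sum>y<n. M $$ (r, x) * X $$ (x, y) * cnj (M $$ (s, y)))"
proof -
  have "(M * X * mat_adjoint M) $$ (r, s) =
      (\<Sum>y<n. (M * X) $$ (r, y) * mat_adjoint M $$ (y, s))"
    by (intro mult_mat_index[of _ n n _ n]) (use assms in simp_all)
  also have "\<dots> = (\<Sum>y<n. \<Sum>x<n. M $$ (r, x) * X $$ (x, y) * cnj (M $$ (s, y)))"
  proof (rule sum.cong[OF refl])
    fix y assume "y \<in> {..<n}"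
    then show "(M * X) $$ (r, y) * mat_adjoint M $$ (y, s) =
        (\<Sum>x<n. M $$ (r, x) * X $$ (x, y) * cnj (M $$ (s, y)))"
      using mult_mat_index[OF M X \<open>r < n\<close>, of y] assms by (simp add: sum_distrib_right)
  qed
  also have "\<dots> = (\<Sum>x<n. \<Sum>y<n. M $$ (r, x) * X $$ (x, y) * cnj (M $$ (s, y)))"
    by (rule sum.swap)
  finally show ?thesis .
qed

lemma sandwich_unit_index:
  fixes M :: cmat
  assumes "M \<in> carrier_mat n n" "i < n" "j < n" "r < n" "s < n"
  shows "(M * mat_unit n i j * mat_adjoint M) $$ (r, s) = M $$ (r, i) * cnj (M $$ (s, j))"
proof -
  have "(M * mat_unit n i j * mat_adjoint M) $$ (r, s) =
      (\<Sum>x<n. \<Sum>y<n. M $$ (r, x) * mat_unit n i j $$ (x, y) * cnj (M $$ (s, y)))"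
    by (intro sandwich_index) (use assms in simp_all)
  also have "\<dots> = (\<Sum>x<n. \<Sum>y<n. if y = j then if x = i then M $$ (r, x) * cnj (M $$ (s, y)) else 0 else 0)"
    by (intro sum.cong) auto
  also have "\<dots> = M $$ (r, i) * cnj (M $$ (s, j))"
    using assms by (simp add: sum.delta)
  finally show ?thesis .
qed

lemma trace_mat_sum: "mat_trace (mat_sum n I A) = (\<Sum>a\<in>I. \<Sum>i<n. A a $$ (i, i))"
  by (simp add: mat_trace_def sum.swap[of _ I])


subsection \<open>Kronecker products\<close>

lemma kron_dim [simp]:
  "dim_row (kron A B) = dim_row A * dim_row B" "dim_col (kron A B) = dim_col A * dim_col B"
  by (simp_all add: kron_def)

lemma kron_carrier [simp]:
  "A \<in> carrier_mat n n' \<Longrightarrow> B \<in> carrier_mat m m' \<Longrightarrow> kron A B \<in> carrier_mat (n * m) (n' * m')"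
  by (intro carrier_matI) (simp_all add: carrier_matD)

lemma kron_index:
  "r < dim_row A * dim_row B \<Longrightarrow> s < dim_col A * dim_col B \<Longrightarrow>
    kron A B $$ (r, s) =
      A $$ (r div dim_row B, s div dim_col B) * B $$ (r mod dim_row B, s mod dim_col B)"
  by (simp add: kron_def)

text \<open>Both groupings number the label triple \<open>(i, j, k)\<close> alike, since
  \<open>(i * b + j) * c + k = i * (b * c) + (j * c + k)\<close>. This later moves a receiver's
  factor across the cut between receivers and independent parties.\<close>

lemma kron_assoc: "kron A (kron B C) = kron (kron A B) C"
proof (rule eq_matI)
  fix r s
  assume rs: "r < dim_row (kron (kron A B) C)" "s < dim_col (kron (kron A B) C)"
  have r: "r < dim_row A * (dim_row B * dim_row C)"
    and s: "s < dim_col A * (dim_col B * dim_col C)"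
    using rs by (simp_all add: mult.assoc)
  have quot: "t div (b * c) = t div c div b" and rem: "t mod (b * c) div c = t div c mod b"
    "t mod (b * c) mod c = t mod c" if "0 < b * c" for t b c :: nat
    using that by (simp_all add: div_mult2_eq mult.commute[of b c] mod_mult2_eq)
  have rB: "0 < dim_row B * dim_row C" and sB: "0 < dim_col B * dim_col C"
    using r s by (auto intro: gr0I)
  show "kron A (kron B C) $$ (r, s) = kron (kron A B) C $$ (r, s)"
    using rs r s div_mod_less[OF r] div_mod_less[OF s]
      div_mod_less[of r "dim_row A * dim_row B" "dim_row C"]
      div_mod_less[of s "dim_col A * dim_col B" "dim_col C"]
    by (simp add: kron_index quot[OF rB] rem[OF rB] quot[OF sB] rem[OF sB])
qed (simp_all add: mult.assoc)

lemma kron_mult: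
  assumes A: "A \<in> carrier_mat n n" and B: "B \<in> carrier_mat m m"
    and C: "C \<in> carrier_mat n n" and D: "D \<in> carrier_mat m m"
  shows "kron A B * kron C D = kron (A * C) (B * D)"
proof (rule eq_matI)
  fix r s
  assume "r < dim_row (kron (A * C) (B * D))" "s < dim_col (kron (A * C) (B * D))"
  then have r: "r < n * m" and s: "s < n * m" using assms by simp_all
  note rs = div_mod_less[OF r] div_mod_less[OF s]
  have "(kron A B * kron C D) $$ (r, s) =
      (\<Sum>x<n * m. kron A B $$ (r, x) * kron C D $$ (x, s))"
    by (rule mult_mat_index[of _ "n * m" _ _ "n * m"]) (use assms r s in simp_all)
  also have "\<dots> = (\<Sum>i<n. \<Sum>k<m. (A $$ (r div m, i) * C $$ (i, s div m)) *
      (B $$ (r mod m, k) * D $$ (k, s mod m)))"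
    unfolding sum_lessThan_mult
    using assms r s by (intro sum.cong) (auto simp: kron_index mult_add_less)
  also have "\<dots> = (A * C) $$ (r div m, s div m) * (B * D) $$ (r mod m, s mod m)"
    by (simp only: mult_mat_index[OF A C rs(1,3)] mult_mat_index[OF B D rs(2,4)] sum_product)
  also have "\<dots> = kron (A * C) (B * D) $$ (r, s)"
    using assms r s by (simp add: kron_index)
  finally show "(kron A B * kron C D) $$ (r, s) = kron (A * C) (B * D) $$ (r, s)" .
qed (use assms in simp_all)

lemma mat_adjoint_kron: "mat_adjoint (kron A B) = kron (mat_adjoint A) (mat_adjoint B)"
  by (rule eq_matI) (auto simp: kron_index div_mod_less)

lemma kron_sandwich:
  assumes "A \<in> carrier_mat n n" "B \<in> carrier_mat m m" "X \<in> carrier_mat n n" "Y \<in> carrier_mat m m"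
  shows "kron A B * kron X Y * mat_adjoint (kron A B) =
    kron (A * X * mat_adjoint A) (B * Y * mat_adjoint B)"
  using assms by (simp add: mat_adjoint_kron kron_mult[of _ n _ m])

lemma trace_kron:
  assumes "A \<in> carrier_mat n n" "B \<in> carrier_mat m m"
  shows "mat_trace (kron A B) = mat_trace A * mat_trace B"
proof -
  have "mat_trace (kron A B) = (\<Sum>i<n. \<Sum>k<m. A $$ (i, i) * B $$ (k, k))"
    unfolding mat_trace_def using assms
    by (simp add: sum_lessThan_mult) (intro sum.cong, auto simp: kron_index mult_add_less)
  also have "\<dots> = mat_trace A * mat_trace B"
    using assms by (simp add: mat_trace_def sum_product)
  finally show ?thesis .
qed


subsection \<open>Kraus representations of tensor products of maps\<close>

text \<open>The set \<open>S\<close> carries the shape of the Kraus operators through tensor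
  products. Normalisation is left to the trace preservation of the complete map, because a single
  branch of a separable operation may be probabilistic.\<close>

definition has_kraus :: "nat \<Rightarrow> cmat set \<Rightarrow> (cmat \<Rightarrow> cmat) \<Rightarrow> bool" where
  "has_kraus n S E \<longleftrightarrow> (\<exists>(K :: nat) M. (\<forall>a<K. M a \<in> S) \<and>
     (\<forall>X\<in>carrier_mat n n. E X = mat_sum n {..<K} (\<lambda>a. M a * X * mat_adjoint (M a))))"

lemma has_kraus_mono: "has_kraus n S E \<Longrightarrow> S \<subseteq> T \<Longrightarrow> has_kraus n T E"
  unfolding has_kraus_def by (meson subset_iff)

text \<open>The carrier assumptions fix the dimensions by which \<open>kron\<close> splits
  \<open>r\<close> and \<open>s\<close> into quotient and remainder.\<close>

lemma map_tensor_index: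
  assumes F: "\<And>k l. k < m \<Longrightarrow> l < m \<Longrightarrow> F (mat_unit m k l) \<in> carrier_mat m m"
    and E: "\<And>i j. i < n \<Longrightarrow> j < n \<Longrightarrow> E (mat_unit n i j) \<in> carrier_mat n n"
    and r: "r < n * m" and s: "s < n * m"
  shows "map_tensor n m E F X $$ (r, s) =
    (\<Sum>i<n. \<Sum>j<n. \<Sum>k<m. \<Sum>l<m. X $$ (i * m + k, j * m + l) *
      (E (mat_unit n i j) $$ (r div m, s div m) * F (mat_unit m k l) $$ (r mod m, s mod m)))"
proof -
  have "map_tensor n m E F X $$ (r, s) =
    (\<Sum>((i, j), (k, l))\<in>({..<n} \<times> {..<n}) \<times> ({..<m} \<times> {..<m}). X $$ (i * m + k, j * m + l) *
      (E (mat_unit n i j) $$ (r div m, s div m) * F (mat_unit m k l) $$ (r mod m, s mod m)))"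
    unfolding map_tensor_def using r s
    by (simp, intro sum.cong) (auto simp: kron_index F[THEN carrier_matD(1)] F[THEN carrier_matD(2)]
        E[THEN carrier_matD(1)] E[THEN carrier_matD(2)])
  then show ?thesis
    by (simp add: sum.cartesian_product' split_def)
qed

text \<open>On a product of matrix units the Kraus sums of \<open>E\<close> and \<open>F\<close>
  multiply out to one double sum over the pairs \<open>kron (M a) (R b)\<close>; linearity extends
  this to every \<open>X\<close>.\<close>

lemma has_kraus_map_tensor:
  assumes E: "has_kraus n S E" and F: "has_kraus m T F"
    and S: "S \<subseteq> carrier_mat n n" and T: "T \<subseteq> carrier_mat m m"
  shows "has_kraus (n * m) {kron A B | A B. A \<in> S \<and> B \<in> T} (map_tensor n m E F)"
proof -
  obtain K :: nat and M where M: "\<And>a. a < K \<Longrightarrow> M a \<in> S"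
    and EM: "\<And>X. X \<in> carrier_mat n n \<Longrightarrow>
      E X = mat_sum n {..<K} (\<lambda>a. M a * X * mat_adjoint (M a))"
    using E unfolding has_kraus_def by blast
  obtain L :: nat and R where R: "\<And>a. a < L \<Longrightarrow> R a \<in> T"
    and FR: "\<And>X. X \<in> carrier_mat m m \<Longrightarrow>
      F X = mat_sum m {..<L} (\<lambda>a. R a * X * mat_adjoint (R a))"
    using F unfolding has_kraus_def by blast
  have Mc: "M a \<in> carrier_mat n n" if "a < K" for a using M[OF that] S by auto
  have Rc: "R a \<in> carrier_mat m m" if "a < L" for a using R[OF that] T by auto
  \<comment> \<open>The pair \<open>(a, b)\<close> of Kraus labels gets the number
    \<open>a * L + b\<close>, the same encoding as for basis labels, so
    \<open>sum_lessThan_mult\<close> also splits the Kraus sum.\<close>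
  define Q where "Q c = kron (M (c div L)) (R (c mod L))" for c
  have "map_tensor n m E F X = mat_sum (n * m) {..<K * L} (\<lambda>c. Q c * X * mat_adjoint (Q c))"
    if X: "X \<in> carrier_mat (n * m) (n * m)" for X
  proof (rule eq_matI)
    fix r s
    assume "r < dim_row (mat_sum (n * m) {..<K * L} (\<lambda>c. Q c * X * mat_adjoint (Q c)))"
      "s < dim_col (mat_sum (n * m) {..<K * L} (\<lambda>c. Q c * X * mat_adjoint (Q c)))"
    then have r: "r < n * m" and s: "s < n * m" by simp_all
    note rs = div_mod_less[OF r] div_mod_less[OF s]
    let ?t = "\<lambda>a b i j k l. M a $$ (r div m, i) * R b $$ (r mod m, k) *
      X $$ (i * m + k, j * m + l) * cnj (M a $$ (s div m, j) * R b $$ (s mod m, l))"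
    have "(Q (a * L + b) * X * mat_adjoint (Q (a * L + b))) $$ (r, s) =
        (\<Sum>i<n. \<Sum>k<m. \<Sum>j<n. \<Sum>l<m. ?t a b i j k l)" if "a < K" "b < L" for a b
    proof -
      have Q: "Q (a * L + b) = kron (M a) (R b)" using that by (simp add: Q_def)
      show ?thesis
        unfolding Q using Mc[OF that(1)] Rc[OF that(2)] X r s
        by (simp add: sandwich_index[of _ "n * m"] sum_lessThan_mult del: index_mult_mat)
          (intro sum.cong, auto simp: kron_index mult_add_less)
    qed
    then have "mat_sum (n * m) {..<K * L} (\<lambda>c. Q c * X * mat_adjoint (Q c)) $$ (r, s) =
        (\<Sum>a<K. \<Sum>b<L. \<Sum>i<n. \<Sum>k<m. \<Sum>j<n. \<Sum>l<m. ?t a b i j k l)"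
      using r s by (simp add: sum_lessThan_mult del: index_mult_mat)
    \<comment> \<open>With the Kraus sums innermost, each term factors into an entry of
      \<open>E (mat_unit n i j)\<close> and an entry of \<open>F (mat_unit m k l)\<close>.\<close>
    also have "\<dots> = (\<Sum>i<n. \<Sum>j<n. \<Sum>k<m. \<Sum>l<m. \<Sum>a<K. \<Sum>b<L. ?t a b i j k l)"
      unfolding sum.cartesian_product
      by (rule sum.reindex_bij_witness[of _
            "\<lambda>(i, j, k, l, a, b). (a, b, i, k, j, l)" "\<lambda>(a, b, i, k, j, l). (i, j, k, l, a, b)"]) auto
    also have "\<dots> = (\<Sum>i<n. \<Sum>j<n. \<Sum>k<m. \<Sum>l<m. X $$ (i * m + k, j * m + l) *
        (E (mat_unit n i j) $$ (r div m, s div m) * F (mat_unit m k l) $$ (r mod m, s mod m)))"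
    proof (intro sum.cong refl)
      fix i j k l
      assume "i \<in> {..<n}" "j \<in> {..<n}" "k \<in> {..<m}" "l \<in> {..<m}"
      then show "(\<Sum>a<K. \<Sum>b<L. ?t a b i j k l) = X $$ (i * m + k, j * m + l) *
          (E (mat_unit n i j) $$ (r div m, s div m) * F (mat_unit m k l) $$ (r mod m, s mod m))"
        using rs Mc Rc
        by (simp add: EM FR sandwich_unit_index sum_product sum_distrib_left mult_ac
            del: index_mult_mat) (rule sum.swap)
    qed
    also have "\<dots> = map_tensor n m E F X $$ (r, s)"
      by (rule map_tensor_index[symmetric]) (simp_all add: EM FR r s)
    finally show "map_tensor n m E F X $$ (r, s) =
        mat_sum (n * m) {..<K * L} (\<lambda>c. Q c * X * mat_adjoint (Q c)) $$ (r, s)" ..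
  qed (simp_all add: map_tensor_def)
  moreover have "Q c \<in> {kron A B | A B. A \<in> S \<and> B \<in> T}" if "c < K * L" for c
    using div_mod_less[OF that] M R unfolding Q_def by blast
  ultimately show ?thesis unfolding has_kraus_def by blast
qed


section \<open>Incoherent Kraus operators of composite systems\<close>

text \<open>Only the summand with label \<open>k\<close> reaches column \<open>k\<close>, so
  incoherence means at most one nonzero entry per column. This entrywise form is the one used from
  here on.\<close>

lemma incoherent_kraus_iff:
  "incoherent_kraus n M \<longleftrightarrow> M \<in> carrier_mat n n \<and>
    (\<exists>f c. \<forall>k<n. f k < n \<and> (\<forall>r<n. M $$ (r, k) = (if r = f k then c k else 0)))"
proof -
  have entry: "mat_sum n {..<n} (\<lambda>k. c k \<cdot>\<^sub>m mat_unit n (f k) k) $$ (r, k) =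
      (if r = f k then c k else 0)"
    if "r < n" "k < n" for f r k and c :: "nat \<Rightarrow> complex"
  proof -
    have "(c l \<cdot>\<^sub>m mat_unit n (f l) l) $$ (r, k) =
        (if l = k then if r = f l then c l else 0 else 0)" for l
      using that by auto
    then have "mat_sum n {..<n} (\<lambda>k. c k \<cdot>\<^sub>m mat_unit n (f k) k) $$ (r, k) =
        (\<Sum>l<n. if l = k then if r = f l then c l else 0 else 0)"
      using that by (simp only: mat_sum_index)
    also have "\<dots> = (if r = f k then c k else 0)" using that by simp
    finally show ?thesis .
  qed
  show ?thesis
  proof
    assume "incoherent_kraus n M"
    then obtain f c where "\<forall>k<n. f k < n"
      and M: "M = mat_sum n {..<n} (\<lambda>k. c k \<cdot>\<^sub>m mat_unit n (f k) k)"
      unfolding incoherent_kraus_def by blast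
    then show "M \<in> carrier_mat n n \<and>
        (\<exists>f c. \<forall>k<n. f k < n \<and> (\<forall>r<n. M $$ (r, k) = (if r = f k then c k else 0)))"
      using entry[of _ _ c f] by (intro conjI exI[of _ f] exI[of _ c]) auto
  next
    assume "M \<in> carrier_mat n n \<and>
      (\<exists>f c. \<forall>k<n. f k < n \<and> (\<forall>r<n. M $$ (r, k) = (if r = f k then c k else 0)))"
    then obtain f c where M: "M \<in> carrier_mat n n" and f: "\<forall>k<n. f k < n"
      and c: "\<And>r k. r < n \<Longrightarrow> k < n \<Longrightarrow> M $$ (r, k) = (if r = f k then c k else 0)" by blast
    have "M = mat_sum n {..<n} (\<lambda>k. c k \<cdot>\<^sub>m mat_unit n (f k) k)"
      by (rule eq_matI) (use M in \<open>simp_all add: entry c del: mat_sum_index\<close>)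
    with f show "incoherent_kraus n M" unfolding incoherent_kraus_def by blast
  qed
qed

lemma incoherent_kraus_carrier: "incoherent_kraus n M \<Longrightarrow> M \<in> carrier_mat n n"
  by (simp add: incoherent_kraus_iff)

lemma incoherent_kraus_one: "incoherent_kraus n (1\<^sub>m n)"
  unfolding incoherent_kraus_iff
  by (intro conjI exI[of _ "\<lambda>k. k"] exI[of _ "\<lambda>k. 1"]) auto

text \<open>A column of the product is the product of two columns with at most one nonzero entry
  each; the label map acts separately on quotient and remainder.\<close>

lemma incoherent_kraus_kron:
  assumes A: "incoherent_kraus n A" and B: "incoherent_kraus m B"
  shows "incoherent_kraus (n * m) (kron A B)"
proof -
  obtain f c where f: "\<And>k. k < n \<Longrightarrow> f k < n"
    and c: "\<And>r k. r < n \<Longrightarrow> k < n \<Longrightarrow> A $$ (r, k) = (if r = f k then c k else 0)"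
    and Ac: "A \<in> carrier_mat n n"
    using A unfolding incoherent_kraus_iff by blast
  obtain g e where g: "\<And>k. k < m \<Longrightarrow> g k < m"
    and e: "\<And>r k. r < m \<Longrightarrow> k < m \<Longrightarrow> B $$ (r, k) = (if r = g k then e k else 0)"
    and Bc: "B \<in> carrier_mat m m"
    using B unfolding incoherent_kraus_iff by blast
  define h where "h k = f (k div m) * m + g (k mod m)" for k
  define z where "z k = c (k div m) * e (k mod m)" for k
  have "h k < n * m" if "k < n * m" for k
    using div_mod_less[OF that] by (simp add: h_def mult_add_less f g)
  moreover have "kron A B $$ (r, k) = (if r = h k then z k else 0)"
    if r: "r < n * m" and k: "k < n * m" for r k
  proof -
    note rk = div_mod_less[OF r] div_mod_less[OF k]
    \<comment> \<open>Quotient and remainder can be read off \<open>h k\<close> because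
      \<open>g (k mod m) < m\<close>.\<close>
    have "r = h k \<longleftrightarrow> r div m = f (k div m) \<and> r mod m = g (k mod m)"
    proof
      assume "r = h k"
      then show "r div m = f (k div m) \<and> r mod m = g (k mod m)"
        using g[of "k mod m"] rk by (simp add: h_def)
    next
      assume "r div m = f (k div m) \<and> r mod m = g (k mod m)"
      then show "r = h k" using div_mult_mod_eq[of r m] by (simp add: h_def)
    qed
    then show ?thesis
      using Ac Bc r k rk by (simp add: kron_index c e z_def)
  qed
  ultimately show ?thesis
    unfolding incoherent_kraus_iff using kron_carrier[OF Ac Bc]
    by (intro conjI exI[of _ h] exI[of _ z]) simp_all
qed

lemma has_kraus_incoherent_op:
  "incoherent_op n E \<Longrightarrow> has_kraus n (Collect (incoherent_kraus n)) E"
  unfolding incoherent_op_def has_kraus_def mem_Collect_eq by blast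

lemma has_kraus_id: "1\<^sub>m n \<in> S \<Longrightarrow> has_kraus n S (\<lambda>X. X)"
proof -
  assume one: "1\<^sub>m n \<in> S"
  have adj: "mat_adjoint (1\<^sub>m n :: cmat) = 1\<^sub>m n"
    by (rule eq_matI) auto
  have "X = mat_sum n {..<1} (\<lambda>a::nat. 1\<^sub>m n * X * mat_adjoint (1\<^sub>m n))"
    if "X \<in> carrier_mat n n" for X :: cmat
    by (rule eq_matI) (use that in \<open>simp_all add: adj\<close>)
  with one show ?thesis unfolding has_kraus_def
    by (intro exI[of _ "1::nat"] exI[of _ "\<lambda>_. 1\<^sub>m n"]) auto
qed

text \<open>Meant for the independent parties, whose Kraus operators \<open>Q\<close> enter the
  estimate through the weights \<open>mat_trace (Q * \<omega> * mat_adjoint Q)\<close>; the set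
  therefore records their dimension alone.\<close>

lemma maps_tensor_kraus:
  assumes "list_all2 incoherent_op ds Ls"
  shows "has_kraus (prod_list ds) (carrier_mat (prod_list ds) (prod_list ds))
    (maps_tensor (zip ds Ls))"
  using assms
proof (induction rule: list_all2_induct)
  case Nil
  then show ?case by (simp add: has_kraus_id)
next
  case (Cons d ds L Ls)
  have len: "prod_list (map fst (zip ds Ls)) = prod_list ds"
    using list_all2_lengthD[OF Cons.hyps(2)] by simp
  let ?C = "carrier_mat (prod_list ds) (prod_list ds)"
  have "has_kraus (d * prod_list ds) {kron A B | A B. A \<in> Collect (incoherent_kraus d) \<and> B \<in> ?C}
      (map_tensor d (prod_list ds) L (maps_tensor (zip ds Ls)))"
    by (rule has_kraus_map_tensor[OF has_kraus_incoherent_op[OF Cons.hyps(1)] Cons.IH])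
      (auto intro: incoherent_kraus_carrier)
  then show ?case
    by (simp add: len) (erule has_kraus_mono, auto intro: kron_carrier incoherent_kraus_carrier)
qed

text \<open>Induction over the receivers, with all independent parties together as the base case,
  brings every Kraus operator into bipartite form across the cut.\<close>

lemma maps_tensor_append_kraus:
  fixes ds es :: "nat list"
  defines "m \<equiv> prod_list es"
  assumes ds: "list_all2 incoherent_op ds Ls" and es: "list_all2 incoherent_op es Ms"
  shows "has_kraus (prod_list ds * m)
    {kron P Q | P Q. incoherent_kraus (prod_list ds) P \<and> Q \<in> carrier_mat m m}
    (maps_tensor (zip (ds @ es) (Ls @ Ms)))"
  using ds
proof (induction rule: list_all2_induct)
  case Nil
  \<comment> \<open>Without receivers the left factor is one-dimensional, and its operator is the 1
    by 1 identity.\<close>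
  have "Q = kron (1\<^sub>m 1) Q" if "Q \<in> carrier_mat m m" for Q
    by (rule eq_matI) (use that in \<open>auto simp: kron_index\<close>)
  then have "carrier_mat m m \<subseteq> {kron P Q | P Q. incoherent_kraus 1 P \<and> Q \<in> carrier_mat m m}"
    using incoherent_kraus_one[of 1] by blast
  then show ?case
    using has_kraus_mono[OF maps_tensor_kraus[OF es]] by (simp add: m_def)
next
  case (Cons d ds L Ls)
  let ?S = "{kron P Q | P Q. incoherent_kraus (prod_list ds) P \<and> Q \<in> carrier_mat m m}"
  have len: "prod_list (map fst (zip (ds @ es) (Ls @ Ms))) = prod_list ds * m"
    using list_all2_lengthD[OF Cons.hyps(2)] list_all2_lengthD[OF es] by (simp add: m_def)
  \<comment> \<open>Associativity absorbs the new receiver's operator \<open>A\<close> into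
    \<open>P\<close>, where the product stays incoherent.\<close>
  have "{kron A B | A B. A \<in> Collect (incoherent_kraus d) \<and> B \<in> ?S} \<subseteq>
      {kron P Q | P Q. incoherent_kraus (d * prod_list ds) P \<and> Q \<in> carrier_mat m m}"
  proof
    fix X assume "X \<in> {kron A B | A B. A \<in> Collect (incoherent_kraus d) \<and> B \<in> ?S}"
    then obtain A P Q where "incoherent_kraus d A" "incoherent_kraus (prod_list ds) P"
      "Q \<in> carrier_mat m m" "X = kron (kron A P) Q"
      using kron_assoc by auto
    then show "X \<in> {kron P Q | P Q. incoherent_kraus (d * prod_list ds) P \<and> Q \<in> carrier_mat m m}"
      using incoherent_kraus_kron by blast
  qed
  moreover have "has_kraus (d * (prod_list ds * m))
      {kron A B | A B. A \<in> Collect (incoherent_kraus d) \<and> B \<in> ?S}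
      (map_tensor d (prod_list ds * m) L (maps_tensor (zip (ds @ es) (Ls @ Ms))))"
    by (rule has_kraus_map_tensor[OF has_kraus_incoherent_op[OF Cons.hyps(1)] Cons.IH])
      (auto intro: incoherent_kraus_carrier kron_carrier)
  ultimately show ?case
    by (simp only: append_Cons zip_Cons_Cons maps_tensor.simps len prod_list.Cons mult.assoc
        has_kraus_mono)
qed

text \<open>Merges the sum over the branches \<open>b\<close> and the Kraus sum inside each branch
  into a single sum.\<close>

lemma SIO_kraus:
  assumes "\<Lambda> \<in> SIO (ds @ es)"
  obtains I :: "(nat \<times> nat) set" and P Q where "finite I"
    "\<And>i. i \<in> I \<Longrightarrow> incoherent_kraus (prod_list ds) (P i)"
    "\<And>i. i \<in> I \<Longrightarrow> Q i \<in> carrier_mat (prod_list es) (prod_list es)"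
    "\<And>X. X \<in> carrier_mat (prod_list ds * prod_list es) (prod_list ds * prod_list es) \<Longrightarrow>
      \<Lambda> X = mat_sum (prod_list ds * prod_list es) I
        (\<lambda>i. kron (P i) (Q i) * X * mat_adjoint (kron (P i) (Q i)))"
proof -
  let ?n = "prod_list ds" and ?m = "prod_list es"
  let ?S = "{kron P Q | P Q. incoherent_kraus ?n P \<and> Q \<in> carrier_mat ?m ?m}"
  obtain K :: nat and L where L: "\<And>b. b < K \<Longrightarrow> list_all2 incoherent_op (ds @ es) (L b)"
    and \<Lambda>: "\<And>X. X \<in> carrier_mat (?n * ?m) (?n * ?m) \<Longrightarrow>
      \<Lambda> X = mat_sum (?n * ?m) {..<K} (\<lambda>b. maps_tensor (zip (ds @ es) (L b)) X)"
    using assms unfolding SIO_def mem_Collect_eq prod_list.append by blast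
  have kraus: "has_kraus (?n * ?m) ?S (maps_tensor (zip (ds @ es) (L b)))" if b: "b < K" for b
  proof -
    obtain L1 L2 where "L b = L1 @ L2" "list_all2 incoherent_op ds L1" "list_all2 incoherent_op es L2"
      using L[OF b] by (auto simp: list_all2_append1)
    then show ?thesis using maps_tensor_append_kraus by simp
  qed
  \<comment> \<open>Bundling the properties lets the number of Kraus operators and both factor
    families be chosen together as functions of \<open>b\<close>.\<close>
  define G where "G b k P Q \<longleftrightarrow>
      (\<forall>a<k. incoherent_kraus ?n (P a) \<and> Q a \<in> carrier_mat ?m ?m) \<and>
      (\<forall>X\<in>carrier_mat (?n * ?m) (?n * ?m). maps_tensor (zip (ds @ es) (L b)) X =
        mat_sum (?n * ?m) {..<k} (\<lambda>a. kron (P a) (Q a) * X * mat_adjoint (kron (P a) (Q a))))"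
    for b and k :: nat and P Q
  have "\<exists>k P Q. G b k P Q"
    if "b < K" for b
  proof -
    obtain k :: nat and M where M: "\<And>a. a < k \<Longrightarrow> M a \<in> ?S"
      and E: "\<And>X. X \<in> carrier_mat (?n * ?m) (?n * ?m) \<Longrightarrow> maps_tensor (zip (ds @ es) (L b)) X =
        mat_sum (?n * ?m) {..<k} (\<lambda>a. M a * X * mat_adjoint (M a))"
      using kraus[OF \<open>b < K\<close>] unfolding has_kraus_def by blast
    have "\<forall>a. \<exists>P Q. a < k \<longrightarrow> M a = kron P Q \<and> incoherent_kraus ?n P \<and> Q \<in> carrier_mat ?m ?m"
      using M by blast
    then obtain P Q where PQ: "\<And>a. a < k \<Longrightarrow>
        M a = kron (P a) (Q a) \<and> incoherent_kraus ?n (P a) \<and> Q a \<in> carrier_mat ?m ?m"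
      by metis
    show ?thesis
      unfolding G_def by (rule exI[of _ k], rule exI[of _ P], rule exI[of _ Q])
        (use PQ in \<open>simp add: E mat_sum_def\<close>)
  qed
  then obtain k P Q where G: "\<And>b. b < K \<Longrightarrow> G b (k b) (P b) (Q b)"
    by metis
  have PQ: "incoherent_kraus ?n (P b a)" "Q b a \<in> carrier_mat ?m ?m" if "b < K" "a < k b" for b a
    using G[OF that(1)] that(2) unfolding G_def by blast+
  have E: "maps_tensor (zip (ds @ es) (L b)) X = mat_sum (?n * ?m) {..<k b}
      (\<lambda>a. kron (P b a) (Q b a) * X * mat_adjoint (kron (P b a) (Q b a)))"
    if "b < K" "X \<in> carrier_mat (?n * ?m) (?n * ?m)" for b X
    using G[OF that(1)] that(2) unfolding G_def by blast
  show ?thesis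
  \<comment> \<open>A dependent sum is the index set because the number \<open>k b\<close> of Kraus
    operators varies with the branch.\<close>
  proof (rule that[of "Sigma {..<K} (\<lambda>b. {..<k b})" "\<lambda>(b, a). P b a" "\<lambda>(b, a). Q b a"])
    fix X :: cmat assume X: "X \<in> carrier_mat (?n * ?m) (?n * ?m)"
    show "\<Lambda> X = mat_sum (?n * ?m) (Sigma {..<K} (\<lambda>b. {..<k b}))
        (\<lambda>i. kron (case i of (b, a) \<Rightarrow> P b a) (case i of (b, a) \<Rightarrow> Q b a) * X *
          mat_adjoint (kron (case i of (b, a) \<Rightarrow> P b a) (case i of (b, a) \<Rightarrow> Q b a)))"
      by (rule eq_matI) (simp_all add: \<Lambda>[OF X] E X sum.Sigma split_def del: index_mult_mat)
  qed (use PQ in auto)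
qed


section \<open>Tracing out the independent parties\<close>

lemma partial_trace_kron_index:
  assumes "A \<in> carrier_mat n n" "B \<in> carrier_mat m m" "r < n" "s < n"
  shows "(\<Sum>k<m. kron A B $$ (r * m + k, s * m + k)) = mat_trace B * A $$ (r, s)"
proof -
  have "kron A B $$ (r * m + k, s * m + k) = B $$ (k, k) * A $$ (r, s)" if "k < m" for k
    using assms that by (simp add: kron_index mult_add_less)
  then show ?thesis
    using assms by (simp add: mat_trace_def sum_distrib_right)
qed

text \<open>Each diagonal entry of the sandwich is the quadratic form of \<omega> at the conjugate
  of a row of \<open>Q\<close>.\<close>

lemma psd_trace_sandwich_nonneg:
  assumes \<omega>: "psd n \<omega>" and Q: "Q \<in> carrier_mat n n"
  shows "0 \<le> mat_trace (Q * \<omega> * mat_adjoint Q)"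
proof -
  have \<omega>c: "\<omega> \<in> carrier_mat n n" using \<omega> by (simp add: psd_def)
  have "0 \<le> (Q * \<omega> * mat_adjoint Q) $$ (k, k)" if "k < n" for k
  proof -
    define v where "v = vec n (\<lambda>y. cnj (Q $$ (k, y)))"
    have "(\<omega> *\<^sub>v v) \<bullet>c v = (\<Sum>x<n. (\<Sum>y<n. \<omega> $$ (x, y) * cnj (Q $$ (k, y))) * Q $$ (k, x))"
      using \<omega>c by (simp add: scalar_prod_def v_def atLeast0LessThan)
    also have "\<dots> = (Q * \<omega> * mat_adjoint Q) $$ (k, k)"
      by (simp add: sandwich_index[OF Q \<omega>c that that] sum_distrib_left sum_distrib_right mult_ac del: index_mult_mat(1))
    finally have "(\<omega> *\<^sub>v v) \<bullet>c v = (Q * \<omega> * mat_adjoint Q) $$ (k, k)" .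
    moreover have "v \<in> carrier_vec n" by (simp add: v_def)
    ultimately show ?thesis
      using \<omega> unfolding psd_def by metis
  qed
  then show ?thesis
    using Q by (auto simp: mat_trace_def simp del: index_mult_mat(1) intro!: sum_nonneg)
qed


subsection \<open>The $l_1$-norm of coherence\<close>

definition coherence :: "nat \<Rightarrow> cmat \<Rightarrow> real" where
  "coherence n A = (\<Sum>r<n. \<Sum>s<n. if r = s then 0 else cmod (A $$ (r, s)))"

lemma coherence_pos:
  assumes "r < n" "s < n" "r \<noteq> s" "A $$ (r, s) \<noteq> 0"
  shows "0 < coherence n A"
proof -
  have "0 < (if r = s then 0 else cmod (A $$ (r, s)))" using assms by simp
  also have "\<dots> \<le> (\<Sum>s<n. if r = s then 0 else cmod (A $$ (r, s)))"
    using assms by (intro member_le_sum[of s "{..<n}" "\<lambda>s. if r = s then 0 else cmod (A $$ (r, s))"]) auto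
  also have "\<dots> \<le> coherence n A"
    unfolding coherence_def using assms
    by (intro member_le_sum[of r "{..<n}" "\<lambda>r. \<Sum>s<n. if r = s then 0 else cmod (A $$ (r, s))"])
      (auto intro!: sum_nonneg)
  finally show ?thesis .
qed

lemma coherence_mono:
  assumes "\<And>r s. r < n \<Longrightarrow> s < n \<Longrightarrow> r \<noteq> s \<Longrightarrow> cmod (A $$ (r, s)) \<le> c * cmod (B $$ (r, s))"
  shows "coherence n A \<le> c * coherence n B"
  unfolding coherence_def sum_distrib_left using assms by (intro sum_mono) auto

text \<open>The triangle inequality at each off-diagonal position; nonnegative weights pass through
  the modulus.\<close>

lemma coherence_weighted_sum:
  assumes "finite I" "\<And>i. i \<in> I \<Longrightarrow> 0 \<le> w i"
    and "\<And>r s. r < n \<Longrightarrow> s < n \<Longrightarrow> A $$ (r, s) = (\<Sum>i\<in>I. complex_of_real (w i) * B i $$ (r, s))"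
  shows "coherence n A \<le> (\<Sum>i\<in>I. w i * coherence n (B i))"
proof -
  have "coherence n A \<le> (\<Sum>r<n. \<Sum>s<n. \<Sum>i\<in>I. w i * (if r = s then 0 else cmod (B i $$ (r, s))))"
    unfolding coherence_def
  proof (intro sum_mono)
    fix r s assume rs: "r \<in> {..<n}" "s \<in> {..<n}"
    have "cmod (\<Sum>i\<in>I. complex_of_real (w i) * B i $$ (r, s)) \<le> (\<Sum>i\<in>I. w i * cmod (B i $$ (r, s)))"
      by (rule sum_norm_le) (use assms(2) in \<open>simp add: norm_mult\<close>)
    then show "(if r = s then 0 else cmod (A $$ (r, s))) \<le>
        (\<Sum>i\<in>I. w i * (if r = s then 0 else cmod (B i $$ (r, s))))"
      using rs assms(3) by auto
  qed
  also have "\<dots> = (\<Sum>r<n. \<Sum>i\<in>I. \<Sum>s<n. w i * (if r = s then 0 else cmod (B i $$ (r, s))))"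
    by (intro sum.cong refl sum.swap)
  also have "\<dots> = (\<Sum>i\<in>I. \<Sum>r<n. \<Sum>s<n. w i * (if r = s then 0 else cmod (B i $$ (r, s))))"
    by (rule sum.swap)
  also have "\<dots> = (\<Sum>i\<in>I. w i * coherence n (B i))"
    by (simp add: coherence_def sum_distrib_left)
  finally show ?thesis .
qed

text \<open>A single Kraus operator is not normalised, so the bound keeps \<open>p x\<close> and
  \<open>p y\<close> until all operators are summed. Writing \<open>p x\<close> as the trace of the
  image of a basis state makes trace preservation directly applicable to it.\<close>

lemma coherence_incoherent_sandwich:
  assumes P: "incoherent_kraus n P" and \<gamma>: "\<gamma> \<in> carrier_mat n n"
  defines "p x \<equiv> Re (mat_trace (P * mat_unit n x x * mat_adjoint P))"
  shows "coherence n (P * \<gamma> * mat_adjoint P) \<le>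
    (\<Sum>x<n. \<Sum>y<n. (p x + p y) / 2 * (if x = y then 0 else cmod (\<gamma> $$ (x, y))))"
proof -
  obtain f c where f: "\<And>k. k < n \<Longrightarrow> f k < n"
    and c: "\<And>r k. r < n \<Longrightarrow> k < n \<Longrightarrow> P $$ (r, k) = (if r = f k then c k else 0)"
    and Pc: "P \<in> carrier_mat n n"
    using P unfolding incoherent_kraus_iff by blast
  \<comment> \<open>The image of basis state \<open>x\<close> has its only possibly nonzero entry at
    \<open>(f x, f x)\<close>.\<close>
  have p: "p x = (cmod (c x))\<^sup>2" if x: "x < n" for x
  proof -
    have "mat_trace (P * mat_unit n x x * mat_adjoint P) =
        (\<Sum>r<n. if r = f x then c x * cnj (c x) else 0)"
      unfolding mat_trace_def using Pc x
      by (intro sum.cong) (auto simp: sandwich_unit_index c simp del: index_mult_mat(1))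
    also have "\<dots> = c x * cnj (c x)" using f[OF x] by simp
    finally show ?thesis by (simp add: p_def complex_mult_cnj cmod_power2)
  qed
  define t where "t x y = cmod (c x) * cmod (c y) * cmod (\<gamma> $$ (x, y))" for x y
  \<comment> \<open>The entry of \<gamma> at \<open>(x, y)\<close> is moved to
    \<open>(f x, f y)\<close> and counts only if this position is off the diagonal. The nested
    conditionals are shaped so that the sums over \<open>r\<close> and \<open>s\<close>
    collapse.\<close>
  have "coherence n (P * \<gamma> * mat_adjoint P) \<le>
      (\<Sum>r<n. \<Sum>s<n. \<Sum>x<n. \<Sum>y<n.
        if s = f y then if r = f x then if f x = f y then 0 else t x y else 0 else 0)"
    unfolding coherence_def
  proof (intro sum_mono)
    fix r s assume rs: "r \<in> {..<n}" "s \<in> {..<n}"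
    have "cmod ((P * \<gamma> * mat_adjoint P) $$ (r, s)) \<le>
        (\<Sum>x<n. \<Sum>y<n. if s = f y then if r = f x then t x y else 0 else 0)"
      unfolding sandwich_index[OF Pc \<gamma> rs[unfolded lessThan_iff]]
      by (intro sum_norm_le) (use rs in \<open>auto simp: c t_def norm_mult\<close>)
    moreover have "0 \<le> (\<Sum>x<n. \<Sum>y<n.
        if s = f y then if r = f x then if f x = f y then 0 else t x y else 0 else 0)"
      by (intro sum_nonneg) (simp add: t_def)
    moreover have "(if s = f y then if r = f x then t x y else 0 else 0) =
        (if s = f y then if r = f x then if f x = f y then 0 else t x y else 0 else 0)"
      if "r \<noteq> s" for x y using that by simp
    ultimately show "(if r = s then 0 else cmod ((P * \<gamma> * mat_adjoint P) $$ (r, s))) \<le>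
        (\<Sum>x<n. \<Sum>y<n. if s = f y then if r = f x then if f x = f y then 0 else t x y else 0 else 0)"
      by (cases "r = s") (simp_all only: simp_thms if_True if_False refl)
  qed
  also have "\<dots> = (\<Sum>x<n. \<Sum>y<n. \<Sum>r<n. \<Sum>s<n.
        if s = f y then if r = f x then if f x = f y then 0 else t x y else 0 else 0)"
    unfolding sum.cartesian_product
    by (rule sum.reindex_bij_witness[of _ "\<lambda>(x, y, r, s). (r, s, x, y)" "\<lambda>(r, s, x, y). (x, y, r, s)"])
      auto
  also have "\<dots> = (\<Sum>x<n. \<Sum>y<n. if f x = f y then 0 else t x y)"
    by (intro sum.cong refl) (simp add: f)
  \<comment> \<open>If \<open>f x\<close> and \<open>f y\<close> differ, so do \<open>x\<close> and
    \<open>y\<close>; labels merged by \<open>f\<close> only lose off-diagonal mass.\<close>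
  also have "\<dots> \<le> (\<Sum>x<n. \<Sum>y<n. (p x + p y) / 2 * (if x = y then 0 else cmod (\<gamma> $$ (x, y))))"
  proof (intro sum_mono)
    fix x y assume xy: "x \<in> {..<n}" "y \<in> {..<n}"
    \<comment> \<open>AM-GM, with \<open>p\<close> the squared moduli of \<open>c\<close>.\<close>
    have "cmod (c x) * cmod (c y) \<le> (p x + p y) / 2"
      using sum_squares_bound[of "cmod (c x)" "cmod (c y)"] xy by (simp add: p)
    then have "t x y \<le> (p x + p y) / 2 * cmod (\<gamma> $$ (x, y))"
      unfolding t_def by (rule mult_right_mono) simp
    moreover have "0 \<le> (p x + p y) / 2 * cmod (\<gamma> $$ (x, y))"
      using xy by (simp add: p)
    ultimately show "(if f x = f y then 0 else t x y) \<le>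
        (p x + p y) / 2 * (if x = y then 0 else cmod (\<gamma> $$ (x, y)))"
      by auto
  qed
  finally show ?thesis .
qed

section \<open>Monotonicity of coherence under catalytic transformations\<close>

lemma coherence_CO_SIO:
  assumes "\<Phi> \<in> CO_SIO ds" and \<gamma>: "\<gamma> \<in> carrier_mat (prod_list ds) (prod_list ds)"
  shows "coherence (prod_list ds) (\<Phi> \<gamma>) \<le> coherence (prod_list ds) \<gamma>"
proof -
  define n where "n = prod_list ds"
  obtain es \<omega> \<Lambda> where \<omega>: "density (prod_list es) \<omega>" and \<Lambda>: "\<Lambda> \<in> SIO (ds @ es)"
    and \<Phi>: "\<Phi> = (\<lambda>\<gamma>. partial_trace n (prod_list es) (\<Lambda> (kron \<gamma> \<omega>)))"
    using assms(1) unfolding CO_SIO_def n_def by blast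
  define m where "m = prod_list es"
  have \<omega>c: "\<omega> \<in> carrier_mat m m" and \<omega>p: "psd m \<omega>" and \<omega>1: "mat_trace \<omega> = 1"
    using \<omega> by (auto simp: density_def psd_def m_def)
  have \<gamma>c: "\<gamma> \<in> carrier_mat n n" using \<gamma> by (simp add: n_def)
  have tp: "mat_trace (\<Lambda> X) = mat_trace X" if "X \<in> carrier_mat (n * m) (n * m)" for X
    using \<Lambda> that unfolding SIO_def n_def m_def by simp
  obtain I :: "(nat \<times> nat) set" and P Q where I: "finite I"
    and P: "\<And>i. i \<in> I \<Longrightarrow> incoherent_kraus n (P i)"
    and Q: "\<And>i. i \<in> I \<Longrightarrow> Q i \<in> carrier_mat m m"
    and K: "\<And>X. X \<in> carrier_mat (n * m) (n * m) \<Longrightarrow> \<Lambda> X = mat_sum (n * m) I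
        (\<lambda>i. kron (P i) (Q i) * X * mat_adjoint (kron (P i) (Q i)))"
    using SIO_kraus[OF \<Lambda>] unfolding n_def m_def by blast
  define A where "A i X = P i * X * mat_adjoint (P i)" for i X
  define B where "B i = Q i * \<omega> * mat_adjoint (Q i)" for i
  define w where "w i = Re (mat_trace (B i))" for i
  have A: "A i X \<in> carrier_mat n n" if "i \<in> I" for i X
    using incoherent_kraus_carrier[OF P[OF that]] by (auto simp: A_def)
  have B: "B i \<in> carrier_mat m m" if "i \<in> I" for i
    using Q[OF that] by (auto simp: B_def)
  \<comment> \<open>Nonnegativity in the order on complex numbers includes a vanishing imaginary
    part, so the trace is its real part.\<close>
  have w: "mat_trace (B i) = of_real (w i)" "0 \<le> w i" if "i \<in> I" for i
    using psd_trace_sandwich_nonneg[OF \<omega>p Q[OF that]]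
    by (auto simp: w_def B_def less_eq_complex_def complex_eq_iff)
  have \<Lambda>_kron: "\<Lambda> (kron X \<omega>) = mat_sum (n * m) I (\<lambda>i. kron (A i X) (B i))"
    if X: "X \<in> carrier_mat n n" for X
    unfolding K[OF kron_carrier[OF X \<omega>c]]
    by (rule eq_matI)
      (simp_all add: A_def B_def kron_sandwich[OF incoherent_kraus_carrier[OF P] Q X \<omega>c]
        cong: sum.cong del: index_mult_mat(1))
  define p where "p i x = Re (mat_trace (A i (mat_unit n x x)))" for i x
  \<comment> \<open>Trace preservation, tested on the product of a basis state with \<open>\<omega>\<close>.\<close>
  have weights: "(\<Sum>i\<in>I. w i * p i x) = 1" if x: "x < n" for x
  proof -
    have "(\<Sum>i\<in>I. mat_trace (A i (mat_unit n x x)) * mat_trace (B i)) =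
        (\<Sum>i\<in>I. \<Sum>r<n * m. kron (A i (mat_unit n x x)) (B i) $$ (r, r))"
    proof (rule sum.cong[OF refl])
      fix i assume i: "i \<in> I"
      show "mat_trace (A i (mat_unit n x x)) * mat_trace (B i) =
          (\<Sum>r<n * m. kron (A i (mat_unit n x x)) (B i) $$ (r, r))"
        using carrier_matD(1)[OF A[OF i]] carrier_matD(1)[OF B[OF i]]
        unfolding trace_kron[OF A[OF i] B[OF i], symmetric] by (simp add: mat_trace_def)
    qed
    also have "\<dots> = mat_trace (\<Lambda> (kron (mat_unit n x x) \<omega>))"
      by (simp add: \<Lambda>_kron trace_mat_sum)
    also have "\<dots> = mat_trace (mat_unit n x x)"
      using \<omega>c by (simp add: tp trace_kron[of _ n _ m] \<omega>1)
    also have "\<dots> = (\<Sum>r<n. if r = x then 1 else 0)"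
      unfolding mat_trace_def by (intro sum.cong) auto
    also have "\<dots> = 1" using x by simp
    finally have "Re (\<Sum>i\<in>I. mat_trace (A i (mat_unit n x x)) * mat_trace (B i)) = 1" by simp
    then show ?thesis by (simp add: p_def w mult.commute cong: sum.cong)
  qed
  \<comment> \<open>The partial trace replaces each factor \<open>B i\<close> by its trace
    \<open>w i\<close>, leaving a weighted sum on the receivers.\<close>
  have "coherence n (\<Phi> \<gamma>) \<le> (\<Sum>i\<in>I. w i * coherence n (A i \<gamma>))"
  proof (rule coherence_weighted_sum[OF I w(2)])
    fix r s assume rs: "r < n" "s < n"
    have "\<Phi> \<gamma> $$ (r, s) = (\<Sum>k<m. \<Sum>i\<in>I. kron (A i \<gamma>) (B i) $$ (r * m + k, s * m + k))"
      using rs \<gamma>c by (simp add: \<Phi> partial_trace_def \<Lambda>_kron m_def[symmetric] mult_add_less)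
    also have "\<dots> = (\<Sum>i\<in>I. \<Sum>k<m. kron (A i \<gamma>) (B i) $$ (r * m + k, s * m + k))"
      by (rule sum.swap)
    also have "\<dots> = (\<Sum>i\<in>I. complex_of_real (w i) * A i \<gamma> $$ (r, s))"
      using rs by (intro sum.cong refl) (simp add: partial_trace_kron_index[OF A B] w)
    finally show "\<Phi> \<gamma> $$ (r, s) = (\<Sum>i\<in>I. complex_of_real (w i) * A i \<gamma> $$ (r, s))" .
  qed
  also have "\<dots> \<le> (\<Sum>i\<in>I. w i *
      (\<Sum>x<n. \<Sum>y<n. (p i x + p i y) / 2 * (if x = y then 0 else cmod (\<gamma> $$ (x, y)))))"
    using coherence_incoherent_sandwich[OF P \<gamma>c] w(2)
    by (intro sum_mono mult_left_mono) (simp_all add: p_def A_def)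
  also have "\<dots> = (\<Sum>i\<in>I. \<Sum>x<n. \<Sum>y<n.
      w i * ((p i x + p i y) / 2 * (if x = y then 0 else cmod (\<gamma> $$ (x, y)))))"
    by (simp only: sum_distrib_left)
  also have "\<dots> = (\<Sum>x<n. \<Sum>y<n. \<Sum>i\<in>I.
      w i * ((p i x + p i y) / 2 * (if x = y then 0 else cmod (\<gamma> $$ (x, y)))))"
    by (subst sum.swap) (intro sum.cong refl sum.swap)
  \<comment> \<open>Collecting the coefficient of each entry of \<gamma> leaves the mean of two
    sums, both 1 by \<open>weights\<close>.\<close>
  also have "\<dots> = (\<Sum>x<n. \<Sum>y<n. ((\<Sum>i\<in>I. w i * p i x) + (\<Sum>i\<in>I. w i * p i y)) / 2 *
      (if x = y then 0 else cmod (\<gamma> $$ (x, y))))"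
    unfolding sum.distrib[symmetric] sum_divide_distrib sum_distrib_right
    by (intro sum.cong refl) (simp add: algebra_simps)
  also have "\<dots> = coherence n \<gamma>"
    unfolding coherence_def by (intro sum.cong refl) (simp add: weights)
  finally show ?thesis by (simp add: n_def)
qed


subsection \<open>Contraction by the censors\<close>

lemma dephasing_index:
  assumes "\<rho> \<in> carrier_mat d d" "i < d" "j < d"
  shows "dephasing d \<rho> $$ (i, j) = (if i = j then \<rho> $$ (i, j) else 0)"
proof -
  have "(mat_unit d a a * \<rho> * mat_unit d a a) $$ (i, j) =
      (if a = j then if i = j then \<rho> $$ (i, j) else 0 else 0)" if a: "a < d" for a
  proof -
    \<comment> \<open>Self-adjointness turns the projection on both sides into the form handled by
      \<open>sandwich_index\<close>.\<close>
    have adj: "mat_adjoint (mat_unit d a a) = mat_unit d a a"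
      by (rule eq_matI) auto
    have "(mat_unit d a a * \<rho> * mat_unit d a a) $$ (i, j) =
        (\<Sum>x<d. \<Sum>y<d. mat_unit d a a $$ (i, x) * \<rho> $$ (x, y) * cnj (mat_unit d a a $$ (j, y)))"
      using sandwich_index[OF mat_unit_carrier assms, of a a] by (simp only: adj)
    also have "\<dots> = (\<Sum>x<d. \<Sum>y<d. if y = a then if x = a then
        if i = a \<and> j = a then \<rho> $$ (x, y) else 0 else 0 else 0)"
      using assms by (intro sum.cong) auto
    also have "\<dots> = (if i = a \<and> j = a then \<rho> $$ (a, a) else 0)"
      using a by simp
    finally show ?thesis by auto
  qed
  then have "dephasing d \<rho> $$ (i, j) =
      (\<Sum>a<d. if a = j then if i = j then \<rho> $$ (i, j) else 0 else 0)"
    using assms unfolding dephasing_def by (subst mat_sum_index) (auto intro!: sum.cong simp del: index_mult_mat(1))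
  then show ?thesis using assms by simp
qed

text \<open>An entrywise (Schur) multiplier \<open>t\<close>. The diagonal is bounded too, because
  two distinct labels of a composite may agree in one factor, where \<open>t\<close> is then
  evaluated on the diagonal.\<close>

definition schur_contraction :: "nat \<Rightarrow> real \<Rightarrow> (cmat \<Rightarrow> cmat) \<Rightarrow> bool" where
  "schur_contraction n \<epsilon> E \<longleftrightarrow> (\<exists>t.
     (\<forall>r<n. \<forall>s<n. cmod (t r s) \<le> (if r = s then 1 else \<epsilon>)) \<and>
     (\<forall>X\<in>carrier_mat n n. E X \<in> carrier_mat n n \<and>
       (\<forall>r<n. \<forall>s<n. E X $$ (r, s) = t r s * X $$ (r, s))))"

lemma coherence_schur_contraction:
  assumes "schur_contraction n \<epsilon> E" and X: "X \<in> carrier_mat n n"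
  shows "coherence n (E X) \<le> \<epsilon> * coherence n X"
proof -
  obtain t where t: "\<And>r s. r < n \<Longrightarrow> s < n \<Longrightarrow> cmod (t r s) \<le> (if r = s then 1 else \<epsilon>)"
    and E: "\<And>r s. r < n \<Longrightarrow> s < n \<Longrightarrow> E X $$ (r, s) = t r s * X $$ (r, s)"
    using assms unfolding schur_contraction_def by blast
  show ?thesis
  proof (rule coherence_mono)
    fix r s assume "r < n" "s < n" "r \<noteq> s"
    then show "cmod (E X $$ (r, s)) \<le> \<epsilon> * cmod (X $$ (r, s))"
      using t[of r s] by (simp add: E norm_mult mult_right_mono)
  qed
qed

lemma schur_contraction_censor:
  assumes "0 \<le> \<epsilon>"
  shows "schur_contraction d \<epsilon> (censor d \<epsilon>)"
  unfolding schur_contraction_def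
proof (rule exI[of _ "\<lambda>r s. if r = s then 1 else of_real \<epsilon>"], intro conjI ballI allI impI)
  fix X :: cmat and r s
  assume X: "X \<in> carrier_mat d d"
  have D: "dephasing d X \<in> carrier_mat d d" by (simp add: dephasing_def)
  show "censor d \<epsilon> X \<in> carrier_mat d d" using X D by (simp add: censor_def)
  assume rs: "r < d" "s < d"
  show "censor d \<epsilon> X $$ (r, s) = (if r = s then 1 else of_real \<epsilon>) * X $$ (r, s)"
    using X D rs by (simp add: censor_def dephasing_index[OF X rs] algebra_simps)
qed (use assms in auto)

text \<open>The multipliers multiply. Distinct composite labels differ in some factor, which
  supplies \<epsilon>; the other multiplier is at most 1.\<close>

lemma schur_contraction_map_tensor:
  assumes E: "schur_contraction n \<epsilon> E" and F: "schur_contraction m \<epsilon> F"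
    and \<epsilon>: "0 \<le> \<epsilon>" "\<epsilon> \<le> 1"
  shows "schur_contraction (n * m) \<epsilon> (map_tensor n m E F)"
proof -
  obtain e where e: "\<And>r s. r < n \<Longrightarrow> s < n \<Longrightarrow> cmod (e r s) \<le> (if r = s then 1 else \<epsilon>)"
    and Ec: "\<And>X. X \<in> carrier_mat n n \<Longrightarrow> E X \<in> carrier_mat n n"
    and Ee: "\<And>X r s. X \<in> carrier_mat n n \<Longrightarrow> r < n \<Longrightarrow> s < n \<Longrightarrow> E X $$ (r, s) = e r s * X $$ (r, s)"
    using E unfolding schur_contraction_def by blast
  obtain f where f: "\<And>r s. r < m \<Longrightarrow> s < m \<Longrightarrow> cmod (f r s) \<le> (if r = s then 1 else \<epsilon>)"
    and Fc: "\<And>X. X \<in> carrier_mat m m \<Longrightarrow> F X \<in> carrier_mat m m"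
    and Ff: "\<And>X r s. X \<in> carrier_mat m m \<Longrightarrow> r < m \<Longrightarrow> s < m \<Longrightarrow> F X $$ (r, s) = f r s * X $$ (r, s)"
    using F unfolding schur_contraction_def by blast
  show ?thesis
    unfolding schur_contraction_def
  proof (rule exI[of _ "\<lambda>r s. e (r div m) (s div m) * f (r mod m) (s mod m)"],
      intro conjI ballI allI impI)
    fix r s assume r: "r < n * m" and s: "s < n * m"
    note rs = div_mod_less[OF r] div_mod_less[OF s]
    show "cmod (e (r div m) (s div m) * f (r mod m) (s mod m)) \<le> (if r = s then 1 else \<epsilon>)"
    proof (cases "r div m = s div m")
      case True
      then have "r = s \<longleftrightarrow> r mod m = s mod m"
        by (metis div_mult_mod_eq)
      then have "cmod (e (r div m) (s div m) * f (r mod m) (s mod m)) \<le> 1 * (if r = s then 1 else \<epsilon>)"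
        unfolding norm_mult using e[OF rs(1,3)] f[OF rs(2,4)] True by (intro mult_mono) auto
      then show ?thesis by simp
    next
      case False
      have "cmod (f (r mod m) (s mod m)) \<le> 1"
        using f[OF rs(2,4)] \<epsilon> by (auto split: if_splits)
      then have "cmod (e (r div m) (s div m) * f (r mod m) (s mod m)) \<le> \<epsilon> * 1"
        unfolding norm_mult using e[OF rs(1,3)] \<epsilon> False by (intro mult_mono) auto
      with False show ?thesis by auto
    qed
    fix X :: cmat
    have "map_tensor n m E F X $$ (r, s) = (\<Sum>i<n. \<Sum>j<n. \<Sum>k<m. \<Sum>l<m. X $$ (i * m + k, j * m + l) *
        (E (mat_unit n i j) $$ (r div m, s div m) * F (mat_unit m k l) $$ (r mod m, s mod m)))"
      by (rule map_tensor_index) (simp_all add: Ec Fc r s)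
    \<comment> \<open>\<open>E\<close> and \<open>F\<close> only rescale matrix units, so a single
      quadruple of labels survives.\<close>
    also have "\<dots> = (\<Sum>i<n. \<Sum>j<n. \<Sum>k<m. \<Sum>l<m. if l = s mod m then if k = r mod m then
        if j = s div m then if i = r div m then
          e (r div m) (s div m) * f (r mod m) (s mod m) * X $$ (i * m + k, j * m + l)
        else 0 else 0 else 0 else 0)"
      by (intro sum.cong refl) (simp add: Ee Ff rs)
    also have "\<dots> = e (r div m) (s div m) * f (r mod m) (s mod m) * X $$ (r, s)"
      by (simp add: rs)
    finally show "map_tensor n m E F X $$ (r, s) =
        e (r div m) (s div m) * f (r mod m) (s mod m) * X $$ (r, s)" .
  qed (simp add: map_tensor_def)
qed

lemma schur_contraction_censor_power:
  assumes "0 \<le> \<epsilon>" "\<epsilon> \<le> 1"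
  shows "schur_contraction (prod_list (replicate N d)) \<epsilon> (censor_power N d \<epsilon>)"
proof (induction N)
  case 0
  show ?case
    \<comment> \<open>The empty composite is one-dimensional, so its only label pair is diagonal and
      the multiplier 1 satisfies the bound.\<close>
    unfolding schur_contraction_def
    by (rule exI[of _ "\<lambda>_ _. 1"]) (simp add: censor_power_def)
next
  case (Suc N)
  show ?case
    using schur_contraction_map_tensor[OF schur_contraction_censor[OF assms(1), of d] Suc.IH assms]
    by (simp add: censor_power_def)
qed

theorem theorem5:
  fixes N d :: nat and \<epsilon> :: real
  assumes "N \<ge> 1" and "0 \<le> \<epsilon>" and "\<epsilon> < 1"
  shows "secure_against_account_sharing (prod_list (replicate N d))
           (free_states (replicate N d)) (CO_SIO (replicate N d)) (censor_power N d \<epsilon>)"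
  unfolding secure_against_account_sharing_def
proof (intro allI impI ballI)
  fix \<rho> \<Phi>
  let ?n = "prod_list (replicate N d)"
  assume \<rho>: "density ?n \<rho> \<and> \<rho> \<notin> free_states (replicate N d)"
    and \<Phi>: "\<Phi> \<in> CO_SIO (replicate N d)"
  have \<rho>c: "\<rho> \<in> carrier_mat ?n ?n" using \<rho> by (simp add: density_def psd_def)
  have schur: "schur_contraction ?n \<epsilon> (censor_power N d \<epsilon>)"
    using assms by (intro schur_contraction_censor_power) simp_all
  then have "censor_power N d \<epsilon> \<rho> \<in> carrier_mat ?n ?n"
    using \<rho>c unfolding schur_contraction_def by blast
  then have "coherence ?n (\<Phi> (censor_power N d \<epsilon> \<rho>)) \<le> \<epsilon> * coherence ?n \<rho>"
    using coherence_CO_SIO[OF \<Phi>] coherence_schur_contraction[OF schur \<rho>c] order_trans by blast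
  \<comment> \<open>A density operator that is not free has a nonzero off-diagonal entry.\<close>
  moreover have "0 < coherence ?n \<rho>"
    using \<rho> \<rho>c coherence_pos unfolding free_states_def diagonal_mat_def by auto
  \<comment> \<open>Recovering \<rho> would bound its positive coherence by \<epsilon> times itself,
    against \<epsilon> < 1.\<close>
  ultimately show "\<Phi> (censor_power N d \<epsilon> \<rho>) \<noteq> \<rho>"
    using assms(3) by (auto simp: mult_le_cancel_right1)
qed

end
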